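(* Let $p\ge 2$ and $1\le q\le 3$. Then every $\mathbb{Z}^p$-action ${\bf A}$ on $\mathbb{Z}^q$ such that $\mathrm{Fix}({\bf A})\neq\{0\}$ is liberated affine.
   Context: A $\mathbb{Z}^p$-action on $\mathbb{Z}^q$ is a homomorphism ${\bf A}:\mathbb{Z}^p\to\mathrm{Aut}(\mathbb{Z}^q)=GL(q,\mathbb{Z})$, and $\mathrm{Fix}({\bf A})=\{k\in\mathbb{Z}^q : {\bf A}(\ell)k=k \text{ for all } \ell\in\mathbb{Z}^p\}$. Let $T^q=\mathbb{R}^q/\mathbb{Z}^q$ and let $\mathrm{Affine}(T^q)$ be the group of affine transformations ${\bf x}\mapsto B{\bf x}+{\bf a}$ of $T^q$, with $B\in GL(q,\mathbb{Z})$ and ${\bf a}\in T^q$. An affine $\mathbb{Z}^p$-action on $T^q$ is a homomorphism $\varphi:\mathbb{Z}^p\to\mathrm{Affine}(T^q)$; $\varphi_*$ denotes the induced $\mathbb{Z}^p$-action on $H_1(T^q,\mathbb{Z})=\mathbb{Z}^q$ (the linear part of $\varphi$). The action $\varphi$ is free if $\varphi(\ell)$ has no fixed point on $T^q$ for every $\ell\in\mathbb{Z}^p-\{0\}$. A $\mathbb{Z}^p$-action ${\bf A}$ on $\mathbb{Z}^q$ is liberated affine if there is a free affine $\mathbb{Z}^p$-action $\varphi$ on $T^q$ with $\varphi_*={\bf A}$. *)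

theory Defs
  imports "HOL-Analysis.Analysis"
begin

section \<open>Actions of free abelian groups on integer lattices\<close>

text \<open>A \<open>\<int>\<^sup>p\<close>-action on \<open>\<int>\<^sup>q\<close> is a homomorphism into \<open>GL(q,\<int>)\<close>. As every \<open>A l\<close> is invertible
  over \<open>\<int>\<close>, multiplicativity implies \<open>A 0 = mat 1\<close>.\<close>

definition lattice_action :: "(int ^ 'p \<Rightarrow> int ^ 'q ^ 'q) \<Rightarrow> bool" where
  "lattice_action A \<longleftrightarrow>
     (\<forall>l. invertible (A l)) \<and> (\<forall>l m. A (l + m) = A l ** A m)"

definition Fix :: "(int ^ 'p \<Rightarrow> int ^ 'q ^ 'q) \<Rightarrow> (int ^ 'q) set" where
  "Fix A = {k. \<forall>l. A l *v k = k}"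


section \<open>The torus and its affine transformations\<close>

definition lattice_equiv :: "real ^ 'q \<Rightarrow> real ^ 'q \<Rightarrow> bool" where
  "lattice_equiv x y \<longleftrightarrow> (\<forall>i. x $ i - y $ i \<in> \<int>)"

lemma lattice_equiv_equivp: "equivp (lattice_equiv :: real ^ 'q \<Rightarrow> _)"
proof (rule equivpI)
  show "reflp lattice_equiv"
    by (auto simp: reflp_def lattice_equiv_def)
  show "symp lattice_equiv"
    unfolding symp_def lattice_equiv_def by (metis Ints_minus minus_diff_eq)
  show "transp (lattice_equiv :: real ^ 'q \<Rightarrow> _)"
  proof (rule transpI)
    fix x y z :: "real ^ 'q"
    assume xy: "lattice_equiv x y" and yz: "lattice_equiv y z"
    have "(x $ i - y $ i) + (y $ i - z $ i) \<in> \<int>" for i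
      using xy yz unfolding lattice_equiv_def by (intro Ints_add) auto
    then show "lattice_equiv x z" by (simp add: lattice_equiv_def)
  qed
qed

quotient_type (overloaded) 'q torus = "real ^ ('q::finite)" / lattice_equiv
  by (rule lattice_equiv_equivp)

definition real_mat :: "int ^ 'q ^ 'q \<Rightarrow> real ^ 'q ^ 'q" where
  "real_mat B = (\<chi> i j. real_of_int (B $ i $ j))"

text \<open>The transformation \<open>x \<mapsto> B x + a\<close>; the translation part enters only through its class in
  the torus.\<close>

lift_definition torus_affine :: "int ^ 'q ^ 'q \<Rightarrow> 'q::finite torus \<Rightarrow> 'q torus \<Rightarrow> 'q torus"
  is "\<lambda>B a x. real_mat B *v x + a"
proof -
  fix B :: "int ^ 'q ^ 'q" and a a' x x' :: "real ^ 'q"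
  assume a: "lattice_equiv a a'" and x: "lattice_equiv x x'"
  have "(real_mat B *v x + a) $ i - (real_mat B *v x' + a') $ i \<in> \<int>" for i
  proof -
    have "(real_mat B *v x + a) $ i - (real_mat B *v x' + a') $ i =
        (\<Sum>j\<in>UNIV. of_int (B $ i $ j) * (x $ j - x' $ j)) + (a $ i - a' $ i)"
      by (simp add: matrix_vector_mult_def real_mat_def right_diff_distrib sum_subtractf)
    also have "\<dots> \<in> \<int>"
      using a x by (intro Ints_add Ints_sum Ints_mult Ints_of_int) (auto simp: lattice_equiv_def)
    finally show ?thesis .
  qed
  then show "lattice_equiv (real_mat B *v x + a) (real_mat B *v x' + a')"
    by (simp add: lattice_equiv_def)
qed

definition Affine :: "('q::finite torus \<Rightarrow> 'q torus) set" where
  "Affine = {torus_affine B a | B a. invertible B}"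

text \<open>The linear part of an affine transformation, i.e. the automorphism it induces on
  \<open>H\<^sub>1(T\<^sup>q,\<int>) = \<int>\<^sup>q\<close>. It is well defined by the uniqueness lemma below.\<close>

definition linear_part :: "('q::finite torus \<Rightarrow> 'q torus) \<Rightarrow> int ^ 'q ^ 'q" where
  "linear_part f = (THE B. \<exists>a. f = torus_affine B a)"

lemma torus_affine_linear_unique:
  fixes B B' :: "int ^ 'q ^ 'q::finite"
  assumes "torus_affine B a = torus_affine B' a'"
  shows "B = B'"
proof -
  obtain u u' where u: "a = abs_torus u" "a' = abs_torus u'"
    by (metis Quotient_torus Quotient_abs_rep)
  have eq: "lattice_equiv (real_mat B *v x + u) (real_mat B' *v x + u')" for x
    using fun_cong[OF assms, of "abs_torus x"]
    by (simp add: u torus_affine.abs_eq torus.abs_eq_iff)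
  have "B $ i $ j = B' $ i $ j" for i j
  proof (rule ccontr)
    assume ne: "B $ i $ j \<noteq> B' $ i $ j"
    define d where "d = real_of_int (B $ i $ j) - real_of_int (B' $ i $ j)"
    have d: "d \<noteq> 0" using ne by (simp add: d_def)
    define x :: "real ^ 'q" where "x = axis j (1 / (2 * d))"
    have mv: "(real_mat C *v x) $ i = real_of_int (C $ i $ j) * (1 / (2 * d))"
      for C :: "int ^ 'q ^ 'q"
      by (simp add: matrix_vector_mult_def real_mat_def x_def axis_def if_distrib cong: if_cong)
    have 0: "u $ i - u' $ i \<in> \<int>"
      using eq[of 0] by (simp add: lattice_equiv_def)
    have "(real_mat B *v x + u) $ i - (real_mat B' *v x + u') $ i \<in> \<int>"
      using eq[of x] by (auto simp: lattice_equiv_def)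
    moreover have "(real_mat B *v x + u) $ i - (real_mat B' *v x + u') $ i =
        1 / 2 + (u $ i - u' $ i)"
    proof -
      have "of_int (B $ i $ j) * (1 / (2 * d)) - of_int (B' $ i $ j) * (1 / (2 * d)) = d * (1 / (2 * d))"
        unfolding d_def by (simp only: left_diff_distrib)
      also have "\<dots> = 1 / 2"
        using d by simp
      finally show ?thesis
        unfolding vector_add_component mv by linarith
    qed
    ultimately have "1 / 2 + (u $ i - u' $ i) \<in> \<int>"
      by (simp only:)
    from Ints_diff[OF this 0] have "(1 / 2 :: real) \<in> \<int>"
      by simp
    then obtain n :: int where "(1 / 2 :: real) = of_int n"
      by (elim Ints_cases)
    then have "real_of_int 1 = of_int (2 * n)"
      by simp
    then have "1 = 2 * n"
      by (simp only: of_int_eq_iff)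
    then show False by presburger
  qed
  then show ?thesis by (simp add: vec_eq_iff)
qed

lemma linear_part_torus_affine [simp]: "linear_part (torus_affine B a) = B"
  unfolding linear_part_def by (rule the_equality) (auto dest: torus_affine_linear_unique)


section \<open>Free affine actions\<close>

definition affine_action :: "(int ^ 'p \<Rightarrow> 'q::finite torus \<Rightarrow> 'q torus) \<Rightarrow> bool" where
  "affine_action \<phi> \<longleftrightarrow>
     (\<forall>l. \<phi> l \<in> Affine) \<and> (\<forall>l m. \<phi> (l + m) = \<phi> l \<circ> \<phi> m)"

definition free_action :: "(int ^ 'p \<Rightarrow> 'q::finite torus \<Rightarrow> 'q torus) \<Rightarrow> bool" where
  "free_action \<phi> \<longleftrightarrow> (\<forall>l. l \<noteq> 0 \<longrightarrow> (\<forall>x. \<phi> l x \<noteq> x))"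

definition induced_action ::
    "(int ^ 'p \<Rightarrow> 'q::finite torus \<Rightarrow> 'q torus) \<Rightarrow> int ^ 'p \<Rightarrow> int ^ 'q ^ 'q" where
  "induced_action \<phi> l = linear_part (\<phi> l)"

definition liberated_affine :: "(int ^ 'p \<Rightarrow> int ^ 'q ^ 'q::finite) \<Rightarrow> bool" where
  "liberated_affine A \<longleftrightarrow>
     (\<exists>\<phi>. affine_action \<phi> \<and> free_action \<phi> \<and> induced_action \<phi> = A)"

end

theory Submission
  imports Defs
begin

text \<open>Suppose finitely many rational cocycles of \<open>A\<close> are such that for each \<open>l \<noteq> 0\<close> one of them has,
  at \<open>l\<close>, a value outside the image of \<open>A l - 1\<close> over \<open>\<rat>\<close>. Combining them with real coefficients that
  are linearly independent over \<open>\<rat>\<close> together with 1 gives the translation part of a free affine action.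
  Cocycles \<open>l \<mapsto> \<alpha> l \<cdot> k\<close> with \<open>k\<close> fixed and \<open>\<alpha>\<close> additive suffice unless all fixed vectors lie
  in the image of one \<open>A l - 1\<close>. In that case, for \<open>q \<le> 3\<close>, the action is, in a suitable rational
  basis, unipotent upper triangular or the sum of a unipotent \<open>2 \<times> 2\<close> block and a character, and an
  explicit polynomial cocycle in the matrix entries handles the remaining \<open>l\<close>.\<close>

section \<open>Cocycles and displacements\<close>

text \<open>For multiplicative \<open>U\<close>, this is the condition that the affine maps
  \<open>y \<mapsto> U l *v y + c l\<close> compose additively in \<open>l\<close>.\<close>

definition cocycle :: "('g::plus \<Rightarrow> 'a::semiring_1 ^ 'q ^ 'q) \<Rightarrow> ('g \<Rightarrow> 'a ^ 'q) \<Rightarrow> bool" where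
  "cocycle U c \<longleftrightarrow> (\<forall>l m. c (l + m) = c l + U l *v c m)"

text \<open>The affine map \<open>y \<mapsto> B *v y + c\<close> has a fixed point exactly when
  \<open>c\<close> lies in this image.\<close>

definition displacements :: "'a::ring_1 ^ 'q ^ 'q \<Rightarrow> ('a ^ 'q) set" where
  "displacements B = range (\<lambda>y. B *v y - y)"

definition rat_mat :: "int ^ 'q ^ 'q \<Rightarrow> rat ^ 'q ^ 'q" where
  "rat_mat B = (\<chi> i j. of_int (B $ i $ j))"

definition real_vec :: "rat ^ 'q \<Rightarrow> real ^ 'q" where
  "real_vec y = (\<chi> i. of_rat (y $ i))"

section \<open>Rational coordinate functionals on the reals\<close>

interpretation rat_real: vector_space "\<lambda>(r::rat) (x::real). of_rat r * x"
  by unfold_locales (simp_all add: algebra_simps of_rat_add of_rat_mult)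

interpretation rat_real_rat: vector_space_pair
  "\<lambda>(r::rat) (x::real). of_rat r * x" "(*) :: rat \<Rightarrow> rat \<Rightarrow> rat" ..

text \<open>A finite basis over the rationals would leave only countably many linear combinations,
  but the reals are uncountable.\<close>

lemma infinite_rational_basis:
  obtains B :: "real set" where "infinite B" "1 \<in> B" "rat_real.independent B"
proof -
  have "rat_real.independent {1::real}"
    by simp
  then obtain B where B: "{1} \<subseteq> B" "rat_real.independent B" "UNIV \<subseteq> rat_real.span B"
    by (rule rat_real.maximal_independent_subset_extend[OF subset_UNIV])
  have "infinite B"
  proof
    assume fin: "finite B"
    define f where "f g = (\<Sum>b\<in>B. of_rat (g b) * b)" for g :: "real \<Rightarrow> rat"
    \<comment> \<open>Only the coefficients on \<open>B\<close> matter, and restricting to them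
      makes the set of coefficient families countable.\<close>
    have "\<exists>h \<in> B \<rightarrow>\<^sub>E UNIV. x = f h" for x
    proof -
      have "x \<in> rat_real.span B" using B(3) by blast
      then obtain g where "x = f g"
        unfolding rat_real.span_finite[OF fin] f_def by (rule rangeE)
      also have "f g = f (restrict g B)"
        unfolding f_def by (rule sum.cong) (simp_all only: restrict_apply if_True)
      finally show ?thesis
        using restrict_PiE_iff[of g B "\<lambda>_. UNIV"] by (metis UNIV_I)
    qed
    then have "f ` (B \<rightarrow>\<^sub>E UNIV) = UNIV" by (metis UNIV_eq_I image_eqI)
    moreover have "countable (B \<rightarrow>\<^sub>E (UNIV :: rat set))"
      using fin by (intro countable_PiE) auto
    ultimately have "countable (UNIV :: real set)"
      using countable_image[of "B \<rightarrow>\<^sub>E UNIV" f] by (simp only:)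
    then show False using uncountable_UNIV_real by blast
  qed
  then show thesis using that B by blast
qed

text \<open>For \<open>i\<close> in \<open>I\<close>, the \<open>t i\<close> are distinct members of
  a Hamel basis containing 1, all different from 1, and \<open>\<pi> i\<close> reads off the
  coordinate at \<open>t i\<close>. As it kills 1, it vanishes on the integers and so does not see
  lattice translations.\<close>

lemma rational_coordinates:
  fixes I :: "'i set"
  assumes "finite I"
  obtains t :: "'i \<Rightarrow> real" and \<pi> :: "'i \<Rightarrow> real \<Rightarrow> rat"
  where "\<And>i x y. \<pi> i (x + y) = \<pi> i x + \<pi> i y"
    and "\<And>i r x. \<pi> i (of_rat r * x) = r * \<pi> i x"
    and "\<And>i. i \<in> I \<Longrightarrow> \<pi> i 1 = 0"
    and "\<And>i j. i \<in> I \<Longrightarrow> j \<in> I \<Longrightarrow> \<pi> i (t j) = (if j = i then 1 else 0)"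
proof -
  obtain B :: "real set" where B: "infinite B" "1 \<in> B" "rat_real.independent B"
    by (rule infinite_rational_basis)
  from B(1) have "infinite (B - {1})" by simp
  then obtain T where T: "finite T" "card T = card I" "T \<subseteq> B - {1}"
    using infinite_arbitrarily_large by metis
  then obtain t where t: "bij_betw t I T"
    using assms by (metis finite_same_card_bij)
  have "\<exists>g. Vector_Spaces.linear (\<lambda>(r::rat) (x::real). of_rat r * x) (*) g
      \<and> (\<forall>x\<in>B. g x = (if x = t i then 1 else 0))" for i
    by (rule rat_real_rat.linear_independent_extend[OF B(3)])
  then obtain \<pi> where
      lin: "\<And>i. Vector_Spaces.linear (\<lambda>(r::rat) (x::real). of_rat r * x) (*) (\<pi> i)"
    and val: "\<And>i x. x \<in> B \<Longrightarrow> \<pi> i x = (if x = t i then 1 else 0)"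
    by metis
  have tB: "t i \<in> B" "t i \<noteq> 1" if "i \<in> I" for i
    using t T(3) that by (auto simp: bij_betw_def)
  show thesis
  proof (rule that[of \<pi> t])
    show "\<pi> i (x + y) = \<pi> i x + \<pi> i y" for i x y
      using lin[of i] unfolding Vector_Spaces.linear_iff by blast
    show "\<pi> i (of_rat r * x) = r * \<pi> i x" for i r x
      using lin[of i] unfolding Vector_Spaces.linear_iff by blast
    show "\<pi> i 1 = 0" if "i \<in> I" for i
      using val[OF B(2)] tB(2)[OF that] by metis
    show "\<pi> i (t j) = (if j = i then 1 else 0)" if "i \<in> I" "j \<in> I" for i j
      using val[OF tB(1)[OF that(2)], of i] t that by (auto simp: bij_betw_def inj_on_def)
  qed
qed

section \<open>From rational cocycles to free affine actions\<close>

lemma real_mat_mult: "real_mat (B ** C) = real_mat B ** real_mat C"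
  by (simp add: real_mat_def matrix_matrix_mult_def vec_eq_iff)

lemma rat_mat_mult: "rat_mat (B ** C) = rat_mat B ** rat_mat C"
  by (simp add: rat_mat_def matrix_matrix_mult_def vec_eq_iff)

lemma real_vec_add: "real_vec (x + y) = real_vec x + real_vec y"
  by (simp add: real_vec_def vec_eq_iff of_rat_add)

lemma real_vec_rat_mat: "real_vec (rat_mat B *v y) = real_mat B *v real_vec y"
  by (simp add: real_vec_def rat_mat_def real_mat_def matrix_vector_mult_def vec_eq_iff
      of_rat_sum of_rat_mult)

text \<open>A rational coordinate functional, applied to the equation of a fixed point of \<open>\<phi> l\<close>,
  exhibits the value at \<open>l\<close> of the corresponding rational cocycle as a displacement.\<close>

lemma liberated_affineI:
  fixes A :: "int ^ 'p \<Rightarrow> int ^ 'q ^ 'q::finite"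
  assumes A: "lattice_action A"
    and C: "finite C" "\<And>c. c \<in> C \<Longrightarrow> cocycle (\<lambda>l. rat_mat (A l)) c"
    and free: "\<And>l. l \<noteq> 0 \<Longrightarrow> \<exists>c\<in>C. c l \<notin> displacements (rat_mat (A l))"
  shows "liberated_affine A"
proof -
  obtain t :: "_ \<Rightarrow> real" and \<pi> :: "_ \<Rightarrow> real \<Rightarrow> rat"
    where \<pi>_add: "\<And>c x y. \<pi> c (x + y) = \<pi> c x + \<pi> c y"
      and \<pi>_mult: "\<And>c r x. \<pi> c (of_rat r * x) = r * \<pi> c x"
      and \<pi>_1: "\<And>c. c \<in> C \<Longrightarrow> \<pi> c 1 = 0"
      and \<pi>_t: "\<And>c d. c \<in> C \<Longrightarrow> d \<in> C \<Longrightarrow> \<pi> c (t d) = (if d = c then 1 else 0)"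
    using rational_coordinates[OF C(1)] by metis
  have \<pi>_0: "\<pi> c 0 = 0" for c using \<pi>_mult[of c 0 0] by simp
  have \<pi>_diff: "\<pi> c (x - y) = \<pi> c x - \<pi> c y" for c x y
    using \<pi>_add[of c "x - y" y] by simp
  have \<pi>_sum: "\<pi> c (\<Sum>i\<in>S. f i) = (\<Sum>i\<in>S. \<pi> c (f i))" for c f and S :: "'x set"
    by (induction S rule: infinite_finite_induct) (simp_all add: \<pi>_0 \<pi>_add)
  have \<pi>_int: "\<pi> c (of_int n * x) = of_int n * \<pi> c x" for c n x
    using \<pi>_mult[of c "of_int n" x] by simp
  \<comment> \<open>A real combination of cocycles is again a cocycle; the coefficients
    \<open>t c\<close> let \<open>\<pi> c\<close> recover each summand.\<close>
  define a where "a l = (\<Sum>c\<in>C. t c *s real_vec (c l))" for l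
  define \<phi> where "\<phi> l = torus_affine (A l) (abs_torus (a l))" for l
  have AA: "A (l + m) = A l ** A m" for l m
    using A by (simp add: lattice_action_def)
  have C_add: "c (l + m) = c l + rat_mat (A l) *v c m" if "c \<in> C" for c l m
    using C(2)[OF that] by (simp add: cocycle_def)
  have a_add: "a (l + m) = real_mat (A l) *v a m + a l" for l m
  proof -
    have "a (l + m) = (\<Sum>c\<in>C. t c *s real_vec (c l) + real_mat (A l) *v (t c *s real_vec (c m)))"
      unfolding a_def
      by (intro sum.cong refl) (simp only: C_add real_vec_add real_vec_rat_mat
          vec.scale_right_distrib vector_scalar_commute)
    also have "\<dots> = a l + real_mat (A l) *v a m"
      unfolding a_def by (simp only: sum.distrib vec.sum)
    finally show ?thesis by (simp add: add.commute)
  qed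
  have "\<phi> (l + m) x = \<phi> l (\<phi> m x)" for l m x
  proof -
    obtain y where "x = abs_torus y"
      by (metis Quotient_torus Quotient_abs_rep)
    then show ?thesis
      by (simp add: \<phi>_def torus_affine.abs_eq AA real_mat_mult a_add matrix_vector_right_distrib
          matrix_vector_mul_assoc add.assoc)
  qed
  then have "affine_action \<phi>"
    using A unfolding affine_action_def Affine_def lattice_action_def \<phi>_def o_def by blast
  moreover have "induced_action \<phi> = A"
    by (simp add: induced_action_def \<phi>_def fun_eq_iff)
  moreover have "free_action \<phi>"
    unfolding free_action_def
  proof (intro allI impI notI)
    fix l :: "int ^ 'p" and x
    assume "l \<noteq> 0" and fix_pt: "\<phi> l x = x"
    then obtain c where c: "c \<in> C" "c l \<notin> displacements (rat_mat (A l))"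
      using free by blast
    obtain y where y: "x = abs_torus y"
      by (metis Quotient_torus Quotient_abs_rep)
    have "lattice_equiv y (real_mat (A l) *v y + a l)"
      using fix_pt unfolding \<phi>_def y
      by (metis torus_affine.abs_eq torus.abs_eq_iff equivp_symp[OF lattice_equiv_equivp])
    then have int: "y $ i - ((real_mat (A l) *v y) $ i + a l $ i) \<in> \<int>" for i
      unfolding lattice_equiv_def by simp
    \<comment> \<open>The sign turns \<open>y = A l y + a l\<close> modulo integers into
      \<open>c l = A l z - z\<close>.\<close>
    define z :: "rat ^ 'q" where "z = (\<chi> i. - \<pi> c (y $ i))"
    have "c l $ i = (rat_mat (A l) *v z - z) $ i" for i
    proof -
      obtain n where "y $ i - ((real_mat (A l) *v y) $ i + a l $ i) = of_int n"
        using int by (metis Ints_cases)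
      then have "\<pi> c (y $ i - ((real_mat (A l) *v y) $ i + a l $ i)) = \<pi> c (of_int n * 1)"
        by simp
      then have "\<pi> c (y $ i) - (\<pi> c ((real_mat (A l) *v y) $ i) + \<pi> c (a l $ i)) = 0"
        unfolding \<pi>_diff \<pi>_add \<pi>_int \<pi>_1[OF c(1)] by simp
      moreover have "\<pi> c ((real_mat (A l) *v y) $ i) = - (rat_mat (A l) *v z) $ i"
        by (simp add: matrix_vector_mult_def real_mat_def rat_mat_def z_def \<pi>_sum \<pi>_int
            sum_negf)
      moreover have "\<pi> c (a l $ i) = c l $ i"
      proof -
        have "\<pi> c (a l $ i) = (\<Sum>d\<in>C. d l $ i * \<pi> c (t d))"
          unfolding a_def real_vec_def
          by (simp add: \<pi>_sum \<pi>_mult mult.commute[of "t _"])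
        also have "\<dots> = (\<Sum>d\<in>C. if d = c then d l $ i else 0)"
          using c(1) by (intro sum.cong) (auto simp: \<pi>_t)
        also have "\<dots> = c l $ i" using C(1) c(1) by simp
        finally show ?thesis .
      qed
      ultimately show ?thesis by (simp add: z_def)
    qed
    then have "c l = rat_mat (A l) *v z - z" by (simp add: vec_eq_iff)
    then show False using c(2) unfolding displacements_def by blast
  qed
  ultimately show ?thesis unfolding liberated_affine_def by blast
qed

section \<open>Bases adapted to a fixed vector in dimension at most 3\<close>

text \<open>For \<open>w \<noteq> 0\<close> this says that \<open>k, v, w\<close> is a basis, and for \<open>w = 0\<close> that \<open>k, v\<close> is one.\<close>

definition frame :: "'a::field ^ 'q \<Rightarrow> 'a ^ 'q \<Rightarrow> 'a ^ 'q \<Rightarrow> bool" where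
  "frame k v w \<longleftrightarrow> (\<forall>y. \<exists>a b c. y = a *s k + b *s v + c *s w) \<and>
     (\<forall>a b c. a *s k + b *s v + c *s w = 0 \<longrightarrow> a = 0 \<and> b = 0)"

lemma frame_obtain:
  assumes "frame k v w"
  obtains a b c where "y = a *s k + b *s v + c *s w"
  using assms unfolding frame_def by blast

text \<open>Subtracting the two combinations settles the first two coefficients; the third then
  follows by cancelling a nonzero \<open>w\<close>.\<close>

lemma frame_eq:
  assumes "frame k v w" and eq: "a *s k + b *s v + c *s w = a' *s k + b' *s v + c' *s w"
  shows "a = a'" "b = b'" "w \<noteq> 0 \<Longrightarrow> c = c'"
proof -
  have "(a - a') *s k + (b - b') *s v + (c - c') *s w = 0"
    using eq by (simp add: algebra_simps vec.scale_left_diff_distrib)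
  then show *: "a = a'" "b = b'"
    using assms(1) unfolding frame_def by (metis eq_iff_diff_eq_0)+
  from eq show "c = c'" if "w \<noteq> 0"
    using that unfolding * by simp
qed

lemma frame_swap:
  assumes "frame k v w" "w \<noteq> 0"
  shows "frame k w v"
  unfolding frame_def
proof (intro conjI allI impI)
  fix y
  obtain a b c where "y = a *s k + b *s v + c *s w"
    using assms(1) by (rule frame_obtain)
  then have "y = a *s k + c *s w + b *s v" by (simp add: add_ac)
  then show "\<exists>a b c. y = a *s k + b *s w + c *s v" by blast
next
  fix a b c
  assume "a *s k + b *s w + c *s v = 0"
  then have "a *s k + c *s v + b *s w = 0 *s k + 0 *s v + 0 *s w" by (simp add: add_ac)
  from frame_eq[OF assms(1) this] assms(2) show "a = 0" "b = 0" by auto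
qed

text \<open>A triangular change of basis, used to normalize \<open>w\<close> while keeping
  \<open>k\<close> and \<open>v\<close>.\<close>

lemma frame_change_third:
  assumes fr: "frame k v w" "w \<noteq> 0" and w': "w' = a *s k + b *s v + r *s w" and r: "r \<noteq> 0"
  shows "frame k v w'" "w' \<noteq> 0"
proof -
  show "frame k v w'"
    unfolding frame_def
  proof (intro conjI allI impI)
    fix y
    obtain a' b' c' where "y = a' *s k + b' *s v + c' *s w"
      using fr(1) by (rule frame_obtain)
    then have "y = (a' - c' / r * a) *s k + (b' - c' / r * b) *s v + (c' / r) *s w'"
      using r by (simp add: w' vec_eq_iff field_simps)
    then show "\<exists>a b c. y = a *s k + b *s v + c *s w'" by blast
  next
    fix a' b' c'
    assume "a' *s k + b' *s v + c' *s w' = 0"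
    then have "(a' + c' * a) *s k + (b' + c' * b) *s v + (c' * r) *s w
        = 0 *s k + 0 *s v + 0 *s w"
      by (simp add: w' vec_eq_iff algebra_simps)
    from frame_eq[OF fr(1) this] fr(2) r show "a' = 0" "b' = 0" by auto
  qed
  show "w' \<noteq> 0"
  proof
    assume "w' = 0"
    then have "a *s k + b *s v + r *s w = 0 *s k + 0 *s v + 0 *s w"
      by (simp add: w')
    from frame_eq(3)[OF fr(1) this fr(2)] r show False by simp
  qed
qed

text \<open>Either \<open>k\<close> and \<open>v\<close> already span and \<open>w = 0\<close> will
  do, or any vector outside their span completes a basis.\<close>

lemma frame_exists:
  fixes k v :: "'a::field ^ 'q"
  assumes "CARD('q) \<le> 3" and "k \<noteq> 0" and v: "v \<notin> vec.span {k}"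
  obtains w where "frame k v w"
proof -
  have kv: "vec.independent {v, k}"
    using assms(2) v by (simp add: vec.independent_insertI)
  have kv_0: "a = 0 \<and> b = 0" if "a *s k + b *s v = 0" for a b
  proof -
    from that have eq: "b *s v = (- a) *s k" by (simp add: add_eq_0_iff2)
    have "b = 0"
    proof (rule ccontr)
      assume "b \<noteq> 0"
      then have "v = (1 / b) *s (b *s v)" by simp
      then have "v = (- a / b) *s k" unfolding eq by simp
      then show False using v by (metis vec.span_base vec.span_scale insertI1)
    qed
    then show ?thesis using eq assms(2) by simp
  qed
  show thesis
  proof (cases "vec.span {v, k} = UNIV")
    case True
    have "frame k v 0"
      unfolding frame_def
    proof (intro conjI allI impI)
      fix y
      have "y \<in> vec.span {v, k}" using True by simp
      then obtain b a where "y - b *s v = a *s k"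
        by (auto simp: vec.span_insert vec.span_singleton)
      then have "y = a *s k + b *s v + 0 *s 0" by (simp add: algebra_simps)
      then show "\<exists>a b c. y = a *s k + b *s v + c *s 0" by blast
    next
      fix a b c
      assume "a *s k + b *s v + c *s 0 = 0"
      then show "a = 0" "b = 0" using kv_0[of a b] by simp_all
    qed
    then show thesis by (rule that)
  next
    case False
    then obtain w where w: "w \<notin> vec.span {v, k}" by blast
    have ind: "vec.independent {w, v, k}"
      using w kv by (rule vec.independent_insertI)
    have "w \<noteq> v" "w \<noteq> k" "v \<noteq> k"
      using w v by (auto simp: vec.span_base)
    then have "card {w, v, k} = 3" by simp
    \<comment> \<open>Three independent vectors span a space of dimension at most 3.\<close>
    then have "vec.span {w, v, k} = UNIV"
      using vec.card_ge_dim_independent[of "{w, v, k}" UNIV] ind assms(1)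
      by (metis subset_UNIV vec_dim_card top.extremum_uniqueI)
    then have span: "\<exists>a b c. y = a *s k + b *s v + c *s w" for y
    proof -
      have "y \<in> vec.span {w, v, k}" using \<open>vec.span {w, v, k} = UNIV\<close> by simp
      then obtain c b a where "y - c *s w - b *s v = a *s k"
        by (auto simp: vec.span_insert vec.span_singleton)
      then have "y = a *s k + b *s v + c *s w" by (simp add: algebra_simps)
      then show ?thesis by blast
    qed
    have "a = 0 \<and> b = 0" if eq: "a *s k + b *s v + c *s w = 0" for a b c
    proof -
      have "c = 0"
      proof (rule ccontr)
        assume "c \<noteq> 0"
        have "c *s w = - (a *s k + b *s v)"
          using eq by (metis add.commute eq_neg_iff_add_eq_0)
        moreover have "w = (1 / c) *s (c *s w)"
          using \<open>c \<noteq> 0\<close> by simp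
        moreover have "(1 / c) *s (- (a *s k + b *s v)) \<in> vec.span {v, k}"
          by (intro vec.span_scale vec.span_neg vec.span_add vec.span_base) auto
        ultimately show False using w by simp
      qed
      then show ?thesis using eq kv_0[of a b] by simp
    qed
    then have "frame k v w" unfolding frame_def using span by blast
    then show thesis by (rule that)
  qed
qed

section \<open>Cocycles that detect displacements of a fixed vector\<close>

locale matrix_action =
  fixes U :: "'g::ab_group_add \<Rightarrow> 'a::field_char_0 ^ 'q ^ 'q"
  assumes hom: "U (l + m) = U l ** U m"
begin

lemma apply_add: "U (l + m) *v y = U l *v (U m *v y)"
  by (simp add: hom matrix_vector_mul_assoc)

lemma commute: "U l *v (U m *v y) = U m *v (U l *v y)"
  by (metis add.commute apply_add)

lemma apply_combination:
  "U l *v (a *s k + b *s v + c *s w) = a *s (U l *v k) + b *s (U l *v v) + c *s (U l *v w)"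
  by (simp add: matrix_vector_right_distrib vector_scalar_commute)

text \<open>The additive multiples of \<open>k\<close> give no obstruction at those \<open>l\<close>
  where \<open>k\<close> is a displacement; the cocycle \<open>c\<close> is to take over exactly
  there.\<close>

definition detectable :: "'a ^ 'q \<Rightarrow> bool" where
  "detectable k \<longleftrightarrow> (\<exists>c. cocycle U c \<and>
     (\<forall>l. k \<in> displacements (U l) \<longrightarrow> c l \<notin> displacements (U l)))"

text \<open>Displacements have no \<open>v\<close> component, and their \<open>k\<close> component
  is a multiple of \<open>x l\<close>. A cocycle with \<open>v\<close> component \<open>x l\<close>
  is thus a displacement only where \<open>x l = 0\<close>, and there \<open>k\<close> is not one.
  The case \<open>w = 0\<close> covers the plane.\<close>

lemma detectable_split:
  assumes fr: "frame k v w" and k: "\<And>l. U l *v k = k"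
    and v: "\<And>l. U l *v v = v + x l *s k" and w: "\<And>l. U l *v w = h l *s w"
  shows "detectable k"
proof -
  have x_add: "x (l + m) = x l + x m" for l m
  proof -
    have "x (l + m) *s k + 1 *s v + 0 *s w = (x l + x m) *s k + 1 *s v + 0 *s w"
      using apply_add[of l m v] unfolding v
      by (simp add: matrix_vector_right_distrib vector_scalar_commute k v vec_eq_iff algebra_simps)
    then show ?thesis by (rule frame_eq(1)[OF fr])
  qed
  \<comment> \<open>This is the integral of \<open>exp (s N) v\<close> for \<open>s\<close> from 0
    to \<open>x l\<close>, where \<open>N\<close> sends \<open>v\<close> to \<open>k\<close> and
    \<open>k\<close> to 0.\<close>
  define c where "c l = ((x l)\<^sup>2 / 2) *s k + x l *s v" for l
  have "cocycle U c"
    unfolding cocycle_def c_def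
    by (simp add: matrix_vector_right_distrib vector_scalar_commute k v x_add vec_eq_iff
        field_simps power2_eq_square)
  moreover have "c l \<notin> displacements (U l)" if disp: "k \<in> displacements (U l)" for l
  proof
    have U: "\<exists>b e. U l *v y - y = (b * x l) *s k + 0 *s v + e *s w" for y
    proof -
      obtain a b e where y: "y = a *s k + b *s v + e *s w"
        using fr by (rule frame_obtain)
      have "U l *v y - y = (b * x l) *s k + 0 *s v + (e * (h l - 1)) *s w"
        unfolding y apply_combination k v w by (simp add: vec_eq_iff algebra_simps)
      then show ?thesis by blast
    qed
    assume "c l \<in> displacements (U l)"
    then obtain b e where "((x l)\<^sup>2 / 2) *s k + x l *s v + 0 *s w = (b * x l) *s k + 0 *s v + e *s w"
      using U unfolding displacements_def c_def by force
    from frame_eq(2)[OF fr this] have "x l = 0" .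
    moreover obtain b e where "1 *s k + 0 *s v + 0 *s w = (b * x l) *s k + 0 *s v + e *s w"
      using U disp unfolding displacements_def by force
    from frame_eq(1)[OF fr this] have "1 = b * x l" .
    ultimately show False by simp
  qed
  ultimately show ?thesis unfolding detectable_def by blast
qed

text \<open>If \<open>c l\<close> is a displacement, the missing \<open>v\<close> component forces
  \<open>x l = 0\<close>; commutation then gives \<open>y l = 0\<close>, and hence
  \<open>z l = 0\<close>. So \<open>U l\<close> is the identity and \<open>k\<close> is not a
  displacement.\<close>

lemma detectable_unipotent:
  assumes fr: "frame k u v" "v \<noteq> 0" and k: "\<And>l. U l *v k = k"
    and u: "\<And>l. U l *v u = u + x l *s k" and v: "\<And>l. U l *v v = v + y l *s u + z l *s k"
    and x: "x l0 \<noteq> 0"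
  shows "detectable k"
proof -
  have Uv: "U l *v (U m *v v) = (z l + z m + x l * y m) *s k + (y l + y m) *s u + 1 *s v" for l m
    by (simp add: matrix_vector_right_distrib vector_scalar_commute k u v vec_eq_iff algebra_simps)
  have v_add: "z (l + m) = z l + z m + x l * y m" "y (l + m) = y l + y m" for l m
  proof -
    have "z (l + m) *s k + y (l + m) *s u + 1 *s v
        = (z l + z m + x l * y m) *s k + (y l + y m) *s u + 1 *s v"
      using apply_add[of l m v] unfolding Uv by (simp add: v add_ac)
    from frame_eq[OF fr(1) this]
    show "z (l + m) = z l + z m + x l * y m" "y (l + m) = y l + y m" by auto
  qed
  \<comment> \<open>Compare \<open>l + m\<close> with \<open>m + l\<close>. Since
    \<open>x l0 \<noteq> 0\<close>, this makes \<open>y\<close> a constant multiple of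
    \<open>x\<close>.\<close>
  have xy: "x l * y m = x m * y l" for l m
    using v_add(1)[of l m] v_add(1)[of m l] by (simp add: add_ac)
  have x_add: "x (l + m) = x l + x m" for l m
  proof -
    have "x (l + m) *s k + 1 *s u + 0 *s v = (x l + x m) *s k + 1 *s u + 0 *s v"
      using apply_add[of l m u]
      by (simp add: matrix_vector_right_distrib vector_scalar_commute k u vec_eq_iff algebra_simps)
    then show ?thesis by (rule frame_eq(1)[OF fr(1)])
  qed
  \<comment> \<open>A \<open>v\<close> coefficient \<open>x\<close> contributes
    \<open>x m * y l\<close> to the \<open>u\<close> coefficient, which is how \<open>z\<close>
    fails to be additive. For the \<open>k\<close> coefficient, \<open>x * z\<close> has the excess
    \<open>(x l + x m) * x l * y m\<close>, one third of the deviation of \<open>x * x * y\<close>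
    from additivity.\<close>
  define c where "c l = (x l * z l - (x l)\<^sup>2 * y l / 3) *s k + z l *s u + x l *s v" for l
  have "cocycle U c"
  proof -
    have "c (l + m) = c l + U l *v c m" for l m
    proof -
      have "U l *v c m = (x m * z m - (x m)\<^sup>2 * y m / 3 + z m * x l + x m * z l) *s k
          + (z m + x m * y l) *s u + x m *s v"
        unfolding c_def apply_combination by (simp add: k u v vec_eq_iff algebra_simps)
      moreover have "x (l + m) * z (l + m) - (x (l + m))\<^sup>2 * y (l + m) / 3
          = x l * z l - (x l)\<^sup>2 * y l / 3 +
            (x m * z m - (x m)\<^sup>2 * y m / 3 + z m * x l + x m * z l)"
      proof -
        have "(x l + x m)\<^sup>2 * (y l + y m)
            = (x l)\<^sup>2 * y l + (x m)\<^sup>2 * y m + 3 * ((x l + x m) * (x l * y m))"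
          using xy[of l m] by algebra
        then show ?thesis
          unfolding x_add v_add by (simp add: add_divide_distrib algebra_simps)
      qed
      moreover have "z (l + m) = z l + (z m + x m * y l)"
        using v_add(1)[of l m] xy[of l m] by simp
      ultimately show ?thesis
        unfolding c_def by (simp add: x_add vec.scale_left_distrib)
    qed
    then show ?thesis unfolding cocycle_def by blast
  qed
  moreover have "c l \<notin> displacements (U l)" if disp: "k \<in> displacements (U l)" for l
  proof
    have U: "\<exists>b e. q = (b * x l + e * z l) *s k + (e * y l) *s u + 0 *s v"
      if "q \<in> displacements (U l)" for q
    proof -
      obtain p where p: "q = U l *v p - p"
        using \<open>q \<in> displacements (U l)\<close> unfolding displacements_def by blast
      obtain a b e where abe: "p = a *s k + b *s u + e *s v"
        using fr(1) by (rule frame_obtain)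
      have "q = (b * x l + e * z l) *s k + (e * y l) *s u + 0 *s v"
        unfolding p abe apply_combination k u v by (simp add: vec_eq_iff algebra_simps)
      then show ?thesis by blast
    qed
    assume "c l \<in> displacements (U l)"
    from U[OF this] obtain b e where
      "(x l * z l - (x l)\<^sup>2 * y l / 3) *s k + z l *s u + x l *s v
        = (b * x l + e * z l) *s k + (e * y l) *s u + 0 *s v"
      unfolding c_def by blast
    from frame_eq[OF fr(1) this] fr(2) have zx: "z l = e * y l" "x l = 0" by auto
    then have "y l = 0" using xy[of l0 l] x by simp
    then have "z l = 0" using zx by simp
    obtain b e where "1 *s k + 0 *s u + 0 *s v = (b * x l + e * z l) *s k + (e * y l) *s u + 0 *s v"
      using U[OF disp] by auto
    from frame_eq(1)[OF fr(1) this] show False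
      using \<open>x l = 0\<close> \<open>z l = 0\<close> by simp
  qed
  ultimately show ?thesis unfolding detectable_def by blast
qed

text \<open>The eigenvalue \<open>e \<noteq> 1\<close> separates \<open>w\<close> from the generalized eigenspace spanned by
  \<open>k\<close> and \<open>v\<close>.\<close>

lemma detectable_eigenvalue:
  assumes fr: "frame k v w" "w \<noteq> 0" and k: "\<And>l. U l *v k = k"
    and l0: "U l0 *v v = v + k" "U l0 *v w = g *s w"
    and m: "U m *v v = v + \<zeta> *s k" "U m *v w = e *s w" and e: "e \<noteq> 1"
  shows "detectable k"
proof -
  have "\<exists>h. U l *v w = h *s w" for l
  proof -
    obtain a b c where abc: "U l *v w = a *s k + b *s v + c *s w"
      using fr(1) by (rule frame_obtain)
    have "(a + b * \<zeta>) *s k + b *s v + (c * e) *s w = (e * a) *s k + (e * b) *s v + (e * c) *s w"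
      using commute[of m l w] unfolding m abc apply_combination vector_scalar_commute
      by (simp add: k m vector_scalar_commute vec_eq_iff algebra_simps)
    from frame_eq[OF fr(1) this] e have "b = 0" "a = 0" by auto
    then show ?thesis using abc by auto
  qed
  \<comment> \<open>Commuting with \<open>U l0\<close> makes the \<open>v\<close> coefficient 1;
    commuting with \<open>U m\<close> kills the \<open>w\<close> coefficient because
    \<open>e \<noteq> 1\<close>.\<close>
  moreover have "\<exists>x. U l *v v = v + x *s k" for l
  proof -
    obtain a b c where abc: "U l *v v = a *s k + b *s v + c *s w"
      using fr(1) by (rule frame_obtain)
    have "(a + b) *s k + b *s v + (c * g) *s w = (a + 1) *s k + b *s v + c *s w"
      using commute[of l0 l v] unfolding l0 abc apply_combination matrix_vector_right_distrib
      by (simp add: k l0 abc vector_scalar_commute vec_eq_iff algebra_simps)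
    from frame_eq(1)[OF fr(1) this] have b: "b = 1" by simp
    have "(a + b * \<zeta>) *s k + b *s v + (c * e) *s w = (a + \<zeta>) *s k + b *s v + c *s w"
      using commute[of m l v]
      unfolding m abc apply_combination matrix_vector_right_distrib vector_scalar_commute
      by (simp add: k m abc vector_scalar_commute vec_eq_iff algebra_simps)
    from frame_eq(3)[OF fr(1) this fr(2)] e have "c = 0" by auto
    then show ?thesis using abc b by (auto simp: add.commute)
  qed
  ultimately obtain x h where "\<And>l. U l *v v = v + x l *s k" "\<And>l. U l *v w = h l *s w"
    by metis
  then show ?thesis using detectable_split[OF fr(1) k] by blast
qed

text \<open>Displacing \<open>k\<close> gives \<open>U l0\<close> a Jordan chain from
  \<open>v\<close> to \<open>k\<close>. The cases follow the Jordan form of \<open>U l0\<close>, and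
  every \<open>U l\<close> is restricted by commuting with it.\<close>

lemma detectable_if_fixed_displaced:
  assumes card: "CARD('q) \<le> 3" and k: "k \<noteq> 0" "\<And>l. U l *v k = k"
    and disp: "\<And>y. (\<And>l. U l *v y = y) \<Longrightarrow> y \<in> displacements (U l0)"
  shows "detectable k"
proof -
  obtain v where "k = U l0 *v v - v"
    using disp[OF k(2)] unfolding displacements_def by blast
  then have v: "U l0 *v v = v + k" by simp
  have "v \<notin> vec.span {k}"
  proof
    assume "v \<in> vec.span {k}"
    then obtain a where "v = a *s k" by (auto simp: vec.span_singleton)
    then show False using v k by (simp add: vector_scalar_commute)
  qed
  then obtain w0 where fr0: "frame k v w0"
    using frame_exists[OF card k(1)] by blast
  show ?thesis
  proof (cases "w0 = 0")
    case True
    have "\<exists>x. U l *v v = v + x *s k" for l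
    proof -
      obtain a b c where abc: "U l *v v = a *s k + b *s v + c *s w0"
        using fr0 by (rule frame_obtain)
      have "(a + b) *s k + b *s v + 0 *s w0 = (a + 1) *s k + b *s v + 0 *s w0"
        using commute[of l0 l v] unfolding v abc apply_combination matrix_vector_right_distrib
        by (simp add: k v abc True vector_scalar_commute vec_eq_iff algebra_simps)
      from frame_eq(1)[OF fr0 this] show ?thesis using abc True by (auto simp: add.commute)
    qed
    then obtain x where "\<And>l. U l *v v = v + x l *s k" by metis
    then show ?thesis
      using detectable_split[OF fr0 k(2), of x "\<lambda>_. 1"] True by simp
  next
    case w0: False
    obtain \<alpha> \<beta> \<gamma> where "U l0 *v w0 - w0 = \<alpha> *s k + \<beta> *s v + \<gamma> *s w0"
      using fr0 by (rule frame_obtain)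
    then have w0_l0: "U l0 *v w0 = w0 + \<alpha> *s k + \<beta> *s v + \<gamma> *s w0"
      by (simp add: algebra_simps)
    consider "\<gamma> \<noteq> 0" | "\<gamma> = 0" "\<beta> \<noteq> 0" | "\<gamma> = 0" "\<beta> = 0" by blast
    then show ?thesis
    proof cases
      case 1
      \<comment> \<open>The coefficients solve the equation for an eigenvector with eigenvalue
        \<open>1 + \<gamma>\<close>.\<close>
      define w where "w = ((\<alpha> + \<beta> / \<gamma>) / \<gamma>) *s k + (\<beta> / \<gamma>) *s v + 1 *s w0"
      note fr = frame_change_third[OF fr0 w0 w_def one_neq_zero]
      have w: "U l0 *v w = (1 + \<gamma>) *s w"
        unfolding w_def apply_combination k v w0_l0 using 1
        by (simp add: vec_eq_iff field_simps)
      \<comment> \<open>Here \<open>l0\<close> itself also serves as the element with eigenvalue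
        different from 1.\<close>
      show ?thesis
        by (rule detectable_eigenvalue[where \<zeta> = 1, OF fr k(2) v w _ w]) (use v 1 in simp_all)
    next
      case 2
      \<comment> \<open>Normalized so that \<open>U l0 - 1\<close> sends \<open>w\<close> to
        \<open>v\<close> and \<open>v\<close> to \<open>k\<close>, a single Jordan block of size
        3.\<close>
      define w where "w = 0 *s k + (- \<alpha> / \<beta>) *s v + (1 / \<beta>) *s w0"
      have "1 / \<beta> \<noteq> 0" using 2 by simp
      note fr = frame_change_third[OF fr0 w0 w_def this]
      have w: "U l0 *v w = w + v"
        unfolding w_def apply_combination k v w0_l0 using 2
        by (simp add: vec_eq_iff field_simps)
      \<comment> \<open>Matrices commuting with a single Jordan block are polynomials in it; fixing
        \<open>k\<close> makes the constant term 1.\<close>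
      have "\<exists>x z. U l *v v = v + x *s k \<and> U l *v w = w + x *s v + z *s k" for l
      proof -
        obtain a b c where Uw: "U l *v w = a *s k + b *s v + c *s w"
          using fr(1) by (rule frame_obtain)
        have Uv: "U l *v v = b *s k + c *s v"
          using commute[of l0 l w] unfolding w Uw apply_combination matrix_vector_right_distrib
          by (simp add: k v w Uw vector_scalar_commute vec_eq_iff algebra_simps)
        have "c *s k = k"
          using commute[of l0 l v] unfolding v Uv matrix_vector_right_distrib vector_scalar_commute
          by (simp add: k v Uv vector_scalar_commute vec_eq_iff algebra_simps)
        then have "c = 1" using k(1) by (metis vec.scale_cancel_right vec.scale_one)
        then show ?thesis using Uv Uw by (intro exI[of _ b] exI[of _ a]) (simp add: add_ac)
      qed
      then obtain x z where
        xz: "\<And>l. U l *v v = v + x l *s k" "\<And>l. U l *v w = w + x l *s v + z l *s k"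
        by metis
      have "x l0 *s k = 1 *s k" using xz(1)[of l0] v by simp
      then have "x l0 \<noteq> 0" using k(1) by auto
      with detectable_unipotent[OF fr k(2) xz] show ?thesis by blast
    next
      case 3
      \<comment> \<open>Subtracting \<open>\<alpha> *s v\<close> makes \<open>w\<close> fixed by
        \<open>U l0\<close>. Then \<open>U l0 - 1\<close> has kernel spanned by \<open>k\<close> and
        \<open>w\<close>, and image spanned by \<open>k\<close>.\<close>
      define w where "w = 0 *s k + (- \<alpha>) *s v + 1 *s w0"
      note fr = frame_change_third[OF fr0 w0 w_def one_neq_zero]
      have w: "U l0 *v w = w"
        unfolding w_def apply_combination k v w0_l0 using 3
        by (simp add: vec_eq_iff algebra_simps)
      have "\<exists>x f. U l *v w = x *s k + f *s w" for l
      proof -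
        obtain a b c where Uw: "U l *v w = a *s k + b *s v + c *s w"
          using fr(1) by (rule frame_obtain)
        have "b *s k = 0"
          using commute[of l0 l w] unfolding w Uw apply_combination
          by (simp add: k v w vector_scalar_commute vec_eq_iff algebra_simps)
        then show ?thesis using Uw k(1) by auto
      qed
      then obtain x f where xf: "\<And>l. U l *v w = x l *s k + f l *s w" by metis
      have "\<exists>y z. U l *v v = v + y *s w + z *s k" for l
      proof -
        obtain a b c where Uv: "U l *v v = a *s k + b *s v + c *s w"
          using fr(1) by (rule frame_obtain)
        have "b *s k = k"
          using commute[of l0 l v] unfolding v Uv apply_combination matrix_vector_right_distrib
          by (simp add: k v w Uv vector_scalar_commute vec_eq_iff algebra_simps)
        then have "b = 1" using k(1) by (metis vec.scale_cancel_right vec.scale_one)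
        then show ?thesis using Uv by (intro exI[of _ c] exI[of _ a]) (simp add: add_ac)
      qed
      then obtain y z where yz: "\<And>l. U l *v v = v + y l *s w + z l *s k" by metis
      show ?thesis
      proof (cases "\<forall>l. f l = 1")
        case True
        then have xw: "U l *v w = w + x l *s k" for l by (simp add: xf add.commute)
        \<comment> \<open>Otherwise \<open>w\<close> would be fixed by the whole action, hence a
          displacement of \<open>U l0\<close>, but these are multiples of \<open>k\<close>.\<close>
        have "\<exists>l. x l \<noteq> 0"
        proof (rule ccontr)
          assume "\<nexists>l. x l \<noteq> 0"
          then have "w \<in> displacements (U l0)" using disp[of w] xw by simp
          then obtain p where p: "w = U l0 *v p - p" unfolding displacements_def by blast
          obtain a b c where abc: "p = a *s k + b *s v + c *s w"
            using fr(1) by (rule frame_obtain)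
          have "0 *s k + 0 *s v + 1 *s w = b *s k + 0 *s v + 0 *s w"
            using p unfolding abc apply_combination k v w by (simp add: vec_eq_iff algebra_simps)
          from frame_eq(3)[OF fr(1) this fr(2)] show False by simp
        qed
        moreover have "v \<noteq> 0" using v k(1) by auto
        ultimately show ?thesis
          using detectable_unipotent[OF frame_swap[OF fr] _ k(2) xw yz] by blast
      next
        case False
        then obtain m where m: "f m \<noteq> 1" by blast
        \<comment> \<open>Chosen so that \<open>w1\<close> is an eigenvector of \<open>U m\<close>
          for \<open>f m\<close> and \<open>U m\<close> moves \<open>v1\<close> only by a multiple
          of \<open>k\<close>. The relations for \<open>U l0\<close> survive because it fixes
          \<open>k\<close> and \<open>w\<close>.\<close>
        define \<delta> where "\<delta> = x m / (f m - 1)"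
        define \<epsilon> where "\<epsilon> = y m / (1 - f m)"
        define w1 where "w1 = \<delta> *s k + 0 *s v + 1 *s w"
        define v1 where "v1 = 0 *s k + \<epsilon> *s w1 + 1 *s v"
        have \<delta>: "\<delta> * f m = x m + \<delta>" and \<epsilon>: "\<epsilon> * f m = \<epsilon> - y m"
          using m by (simp_all add: \<delta>_def \<epsilon>_def field_simps)
        note fr1 = frame_change_third[OF fr w1_def one_neq_zero]
        have "v \<noteq> 0" using v k(1) by auto
        note fr2 = frame_change_third[OF frame_swap[OF fr1] this v1_def one_neq_zero]
        have Uw1: "U m *v w1 = f m *s w1"
          unfolding w1_def apply_combination k xf using \<delta>
          by (simp add: vec_eq_iff algebra_simps)
        have "U m *v v1 = v1 + (z m - y m * \<delta>) *s k"
          unfolding v1_def apply_combination Uw1 k yz vec.scale_scale \<epsilon>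
          by (simp add: w1_def vec_eq_iff algebra_simps)
        moreover have "U l0 *v w1 = 1 *s w1"
          unfolding w1_def apply_combination k v w by simp
        moreover from this have "U l0 *v v1 = v1 + k"
          unfolding v1_def apply_combination k v by (simp add: add_ac)
        ultimately show ?thesis
          using detectable_eigenvalue[OF frame_swap[OF fr2] fr1(2) k(2)] Uw1 m by blast
      qed
    qed
  qed
qed

end

section \<open>Cocycles from fixed vectors, and the conclusion\<close>

lemma subspace_displacements:
  fixes B :: "'a::field ^ 'q ^ 'q"
  shows "vec.subspace (displacements B)"
proof (rule vec.subspaceI)
  show "0 \<in> displacements B"
    unfolding displacements_def by (rule range_eqI[of _ _ 0]) simp
next
  fix x y
  assume "x \<in> displacements B" "y \<in> displacements B"
  then obtain x' y' where "x = B *v x' - x'" "y = B *v y' - y'"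
    unfolding displacements_def by blast
  then show "x + y \<in> displacements B"
    unfolding displacements_def
    by (intro range_eqI[of _ _ "x' + y'"]) (simp add: matrix_vector_right_distrib)
next
  fix c x
  assume "x \<in> displacements B"
  then obtain x' where "x = B *v x' - x'"
    unfolding displacements_def by blast
  then show "c *s x \<in> displacements B"
    unfolding displacements_def
    by (intro range_eqI[of _ _ "c *s x'"])
      (simp add: vector_scalar_commute vec.scale_right_diff_distrib)
qed

lemma cocycle_coordinate:
  fixes U :: "int ^ 'p \<Rightarrow> 'a::field ^ 'q ^ 'q"
  assumes "\<And>l. U l *v y = y"
  shows "cocycle U (\<lambda>l. of_int (l $ i) *s y)"
  using assms by (simp add: cocycle_def vector_scalar_commute vec.scale_left_distrib)

text \<open>Displacements form a subspace, so a nonzero coordinate of \<open>l\<close> can be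
  divided out. Finitely many coordinate cocycles thus serve all nonzero \<open>l\<close>.\<close>

lemma coordinate_not_displacement:
  fixes B :: "'a::field_char_0 ^ 'q ^ 'q" and l :: "int ^ 'p"
  assumes "y \<notin> displacements B" and "l \<noteq> 0"
  shows "\<exists>i. of_int (l $ i) *s y \<notin> displacements B"
proof -
  obtain i where i: "l $ i \<noteq> 0" using assms(2) by (auto simp: vec_eq_iff)
  have "of_int (l $ i) *s y \<notin> displacements B"
  proof
    assume "of_int (l $ i) *s y \<in> displacements B"
    then have "(1 / of_int (l $ i)) *s (of_int (l $ i) *s y) \<in> displacements B"
      by (rule vec.subspace_scale[OF subspace_displacements])
    then show False using i assms(1) by simp
  qed
  then show ?thesis by blast
qed

theorem theorem3:
  fixes A :: "int ^ 'p::finite \<Rightarrow> int ^ 'q ^ 'q::finite"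
  assumes "CARD('p) \<ge> 2"
    and "1 \<le> CARD('q)" and "CARD('q) \<le> 3"
    and "lattice_action A"
    and "Fix A \<noteq> {0}"
  shows "liberated_affine A"
proof -
  define U where "U l = rat_mat (A l)" for l
  interpret matrix_action U
    using assms(4) by unfold_locales (simp add: U_def lattice_action_def rat_mat_mult)
  have "0 \<in> Fix A" by (simp add: Fix_def)
  then obtain k' where k': "k' \<in> Fix A" "k' \<noteq> 0" using assms(5) by blast
  define k :: "rat ^ 'q" where "k = (\<chi> i. of_int (k' $ i))"
  have "k \<noteq> 0" using k'(2) by (simp add: k_def vec_eq_iff)
  have k: "U l *v k = k" for l
  proof -
    have "U l *v k = (\<chi> i. of_int ((A l *v k') $ i))"
      by (simp add: U_def rat_mat_def k_def matrix_vector_mult_def vec_eq_iff)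
    also have "A l *v k' = k'" using k'(1) by (simp add: Fix_def)
    finally show ?thesis by (simp add: k_def)
  qed
  define F where "F = {y. \<forall>l. U l *v y = y}"
  show ?thesis
  \<comment> \<open>If no single \<open>U l\<close> displaces all fixed vectors, multiples of fixed
    vectors suffice; otherwise an additional cocycle is needed.\<close>
  proof (cases "\<exists>l. F \<subseteq> displacements (U l)")
    case True
    then obtain l0 where "F \<subseteq> displacements (U l0)" by blast
    then have "detectable k"
      by (intro detectable_if_fixed_displaced[OF assms(3) \<open>k \<noteq> 0\<close> k]) (auto simp: F_def)
    then obtain c where c: "cocycle U c"
      "\<And>l. k \<in> displacements (U l) \<Longrightarrow> c l \<notin> displacements (U l)"
      unfolding detectable_def by blast
    define C where "C = insert c (range (\<lambda>i l. of_int (l $ i) *s k))"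
    show ?thesis
    proof (rule liberated_affineI[OF assms(4), of C])
      show "finite C" by (simp add: C_def)
      show "cocycle (\<lambda>l. rat_mat (A l)) d" if "d \<in> C" for d
        using that c(1) cocycle_coordinate[of U k, OF k]
        unfolding C_def U_def by blast
      show "\<exists>d\<in>C. d l \<notin> displacements (rat_mat (A l))" if "l \<noteq> 0" for l
      proof (cases "k \<in> displacements (U l)")
        case True
        then show ?thesis using c(2) unfolding C_def U_def by blast
      next
        case False
        from coordinate_not_displacement[OF this that] show ?thesis
          unfolding C_def U_def by force
      qed
    qed
  next
    case False
    obtain B where B: "B \<subseteq> F" "vec.independent B" "F \<subseteq> vec.span B"
      by (rule vec.basis_exists)
    define C where "C = (\<lambda>(i, y) (l :: int ^ 'p). of_int (l $ i) *s y) ` (UNIV \<times> B)"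
    show ?thesis
    proof (rule liberated_affineI[OF assms(4), of C])
      show "finite C" using vec.finiteI_independent[OF B(2)] by (simp add: C_def)
      show "cocycle (\<lambda>l. rat_mat (A l)) d" if dC: "d \<in> C" for d
      proof -
        obtain i y where d: "d = (\<lambda>l. of_int (l $ i) *s y)" "y \<in> B"
          using dC unfolding C_def by auto
        then have "U l *v y = y" for l using B(1) by (auto simp: F_def)
        from cocycle_coordinate[of U, OF this] show ?thesis unfolding d U_def .
      qed
      show "\<exists>d\<in>C. d l \<notin> displacements (rat_mat (A l))" if "l \<noteq> 0" for l
      proof -
        \<comment> \<open>A subspace containing the basis \<open>B\<close> would contain all of
          \<open>F\<close>, so testing the finitely many basis vectors is enough.\<close>
        have "\<not> B \<subseteq> displacements (U l)"
          using False B(3) vec.span_minimal[OF _ subspace_displacements] by blast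
        then obtain y where y: "y \<in> B" "y \<notin> displacements (U l)" by blast
        from coordinate_not_displacement[OF y(2) that] y(1) show ?thesis
          unfolding C_def U_def by fastforce
      qed
    qed
  qed
qed

end
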